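(* For any two integers $2\le a<b$ there is a finite simple connected graph $G$ with $\mathrm{gp}^-(G)=a$, $\mathrm{gp}(G)=b$, and $n(G)=b+\max\{1,a-\lfloor b/2\rfloor\}$.
   Context: A set $S$ of vertices of a connected graph $G$ is a general position set if no shortest path contains three or more vertices of $S$. $\mathrm{gp}(G)$ is the size of a largest general position set; a general position set is maximal if not properly contained in another one, and $\mathrm{gp}^-(G)$ is the size of a smallest maximal general position set. $n(G)$ denotes the number of vertices of $G$. *)

theory Defs
  imports Complex_Main "Graph_Theory.Graph_Theory"
begin

definition shortest_vpath :: "'a vwalk \<Rightarrow> ('a, 'b) pre_digraph \<Rightarrow> bool" where
  "shortest_vpath p G \<longleftrightarrow> vpath p G \<and>
     (\<forall>q. vpath q G \<and> hd q = hd p \<and> last q = last p \<longrightarrow> vwalk_length p \<le> vwalk_length q)"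

definition general_position_set :: "('a, 'b) pre_digraph \<Rightarrow> 'a set \<Rightarrow> bool" where
  "general_position_set G S \<longleftrightarrow> S \<subseteq> verts G \<and>
     \<not> (\<exists>p. shortest_vpath p G \<and> card (set p \<inter> S) \<ge> 3)"

definition maximal_general_position_set :: "('a, 'b) pre_digraph \<Rightarrow> 'a set \<Rightarrow> bool" where
  "maximal_general_position_set G S \<longleftrightarrow> general_position_set G S \<and>
     \<not> (\<exists>T. general_position_set G T \<and> S \<subset> T)"

text \<open>The following two numbers are meaningful for finite graphs only: there, the sets
  of cardinalities are finite and nonempty.\<close>

definition gp :: "('a, 'b) pre_digraph \<Rightarrow> nat" where
  "gp G = Max {card S | S. general_position_set G S}"

definition gp_minus :: "('a, 'b) pre_digraph \<Rightarrow> nat" where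
  "gp_minus G = Min {card S | S. maximal_general_position_set G S}"

end

theory Submission
  imports Defs
begin

text \<open>
  The witness is the union of two cliques \<open>C\<close>, \<open>D\<close> that share \<open>k\<close> vertices and have \<open>p\<close>,
  respectively \<open>q\<close>, private vertices. It has diameter 2, and its only shortest paths on three
  vertices run from \<open>C - D\<close> through \<open>C \<inter> D\<close> to \<open>D - C\<close>. Hence the maximal general position
  sets are exactly \<open>C\<close>, \<open>D\<close> and their symmetric difference, of sizes \<open>k + p\<close>, \<open>k + q\<close> and
  \<open>p + q\<close>. For \<open>k \<le> p \<le> q\<close> this gives \<open>gp\<^sup>- = k + p\<close>, \<open>gp = p + q\<close> and order \<open>p + q + k\<close>,
  and \<open>k = max 1 (a - \<lfloor>b/2\<rfloor>)\<close>, \<open>p = a - k\<close>, \<open>q = b - p\<close> realises the required values.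
\<close>

text \<open>Parametrised by the vertex sets themselves, so that all but the final count is set
  algebra on the three blocks \<open>C - D\<close>, \<open>C \<inter> D\<close> and
  \<open>D - C\<close>.\<close>

definition two_cliques :: "'a set \<Rightarrow> 'a set \<Rightarrow> 'a pair_pre_digraph" where
  "two_cliques C D = \<lparr> pverts = C \<union> D,
     parcs = {(x, y). x \<noteq> y \<and> (x \<in> C \<and> y \<in> C \<or> x \<in> D \<and> y \<in> D)} \<rparr>"

lemma pverts_two_cliques [simp]: "pverts (two_cliques C D) = C \<union> D"
  by (simp add: two_cliques_def)

lemma parcs_two_cliques [simp]:
  "(x, y) \<in> parcs (two_cliques C D) \<longleftrightarrow> x \<noteq> y \<and> (x \<in> C \<and> y \<in> C \<or> x \<in> D \<and> y \<in> D)"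
  by (simp add: two_cliques_def)

lemma pair_graph_two_cliques:
  assumes "finite C" "finite D"
  shows "pair_graph (two_cliques C D)"
proof unfold_locales
  have "parcs (two_cliques C D) \<subseteq> (C \<union> D) \<times> (C \<union> D)"
    by auto
  then show "finite (parcs (two_cliques C D))"
    using assms by (meson finite_SigmaI finite_UnI finite_subset)
  show "symmetric (with_proj (two_cliques C D))"
    by (auto simp: symmetric_def intro!: symI)
qed (use assms in auto)

lemma connected_two_cliques:
  assumes "C \<inter> D \<noteq> {}"
  shows "Digraph_Component.connected (with_proj (two_cliques C D))"
proof -
  let ?G = "two_cliques C D"
  let ?R = "rtrancl_on (C \<union> D) ((parcs ?G)\<^sup>s)"
  obtain c where c: "c \<in> C" "c \<in> D"
    using assms by blast
  have step: "(u, v) \<in> ?R" if "u \<in> C \<and> v \<in> C \<or> u \<in> D \<and> v \<in> D" for u v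
  proof (cases "u = v")
    case False
    then have "(u, v) \<in> (parcs ?G)\<^sup>s"
      using that by (simp add: symcl_def)
    then show ?thesis
      using that by (auto intro: rtrancl_on_into_rtrancl_on)
  qed (use that in auto)
  have "(u, v) \<in> ?R" if "u \<in> C \<union> D" "v \<in> C \<union> D" for u v
    using that c step[of u c] step[of c v] by (auto intro: rtrancl_on_trans)
  then show ?thesis
    using c by (auto simp: connected_conv)
qed

lemma shortest_vpath_two_cliquesI:
  assumes "x \<in> C - D" "y \<in> C \<inter> D" "z \<in> D - C"
  shows "shortest_vpath [x, y, z] (with_proj (two_cliques C D))"
  unfolding shortest_vpath_def
proof (intro conjI allI impI)
  let ?G = "with_proj (two_cliques C D)"
  show "vpath [x, y, z] ?G"
    using assms by (auto simp: vpath_def vwalk_def)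
  fix p
  assume p: "vpath p ?G \<and> hd p = hd [x, y, z] \<and> last p = last [x, y, z]"
  \<comment> \<open>A path is nonempty; one vertex would force \<open>x = z\<close>, and two would
    need an arc between \<open>C - D\<close> and \<open>D - C\<close>.\<close>
  then have "length p \<noteq> 0" "length p \<noteq> 1" "length p \<noteq> 2"
    using assms by (auto simp: vpath_def vwalk_def length_Suc_conv numeral_2_eq_2)
  then have "3 \<le> length p"
    by linarith
  then show "vwalk_length [x, y, z] \<le> vwalk_length p"
    by simp
qed

text \<open>A shared vertex is adjacent to all others, so no distance exceeds 2. The bound 3 counts
  vertices, whereas \<open>vwalk_length\<close> counts arcs.\<close>

lemma length_shortest_vpath_two_cliques:
  assumes "C \<inter> D \<noteq> {}" "shortest_vpath p (with_proj (two_cliques C D))"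
  shows "length p \<le> 3"
proof -
  let ?G = "with_proj (two_cliques C D)"
  obtain c where c: "c \<in> C" "c \<in> D"
    using assms(1) by blast
  have p: "vpath p ?G"
    and min: "\<And>q. vpath q ?G \<Longrightarrow> hd q = hd p \<Longrightarrow> last q = last p \<Longrightarrow> length p - 1 \<le> length q - 1"
    using assms(2) by (auto simp: shortest_vpath_def)
  have ends: "hd p \<in> C \<union> D" "last p \<in> C \<union> D"
    using p by (auto simp: vpath_def vwalk_def subset_iff)
  consider "hd p = last p"
    | "hd p \<noteq> last p" "hd p \<in> C \<and> last p \<in> C \<or> hd p \<in> D \<and> last p \<in> D"
    | "hd p \<in> C - D \<and> last p \<in> D - C \<or> hd p \<in> D - C \<and> last p \<in> C - D"
    using ends by blast
  then show ?thesis
  proof cases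
    case 1
    then have "vpath [hd p] ?G"
      using ends by (auto simp: vpath_def vwalk_def)
    from min[OF this] 1 show ?thesis by simp
  next
    case 2
    then have "vpath [hd p, last p] ?G"
      using ends by (auto simp: vpath_def vwalk_def)
    from min[OF this] show ?thesis by simp
  next
    case 3
    then have "vpath [hd p, c, last p] ?G"
      using c by (auto simp: vpath_def vwalk_def)
    from min[OF this] show ?thesis by simp
  qed
qed

text \<open>A subset of \<open>C \<union> D\<close> violates all three inclusions exactly when it
  meets all three blocks, and three vertices on a shortest path always come from three different
  blocks.\<close>

lemma general_position_set_two_cliques_iff:
  assumes "C \<inter> D \<noteq> {}"
  shows "general_position_set (with_proj (two_cliques C D)) S \<longleftrightarrow>
    S \<subseteq> C \<or> S \<subseteq> D \<or> S \<subseteq> (C - D) \<union> (D - C)" (is "general_position_set ?G S \<longleftrightarrow> ?cases")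
proof
  assume gp: "general_position_set ?G S"
  show ?cases
  proof (rule ccontr)
    assume "\<not> ?cases"
    moreover have "S \<subseteq> C \<union> D"
      using gp by (simp add: general_position_set_def)
    ultimately obtain x y z where xyz: "x \<in> C - D" "y \<in> C \<inter> D" "z \<in> D - C"
      and S: "{x, y, z} \<subseteq> S"
      by blast
    have "set [x, y, z] \<inter> S = {x, y, z}"
      using S by auto
    moreover have "card {x, y, z} = 3"
      using xyz by (auto simp: card_insert_if)
    ultimately show False
      using gp shortest_vpath_two_cliquesI[OF xyz]
      unfolding general_position_set_def by (metis order_refl)
  qed
next
  assume S: ?cases
  have False if p: "shortest_vpath p ?G" and card: "3 \<le> card (set p \<inter> S)" for p
  proof -
    have path: "vpath p ?G"
      using p by (simp add: shortest_vpath_def)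
    have "card (set p \<inter> S) \<le> card (set p)"
      by (intro card_mono) auto
    moreover have len: "length p \<le> 3"
      using length_shortest_vpath_two_cliques[OF assms p] .
    ultimately have eq: "card (set p \<inter> S) = card (set p)" "length p = 3"
      using card card_length[of p] by linarith+
    then have sub: "set p \<subseteq> S"
      by (metis List.finite_set card_subset_eq inf.cobounded1 inf.orderI)
    obtain x y z where xyz: "p = [x, y, z]"
      using eq(2) by (auto simp: numeral_3_eq_3 length_Suc_conv)
    \<comment> \<open>The path \<open>[x, z]\<close> would be shorter than \<open>p\<close>. So
      \<open>x\<close> and \<open>z\<close> are private to different cliques, and \<open>y\<close>,
      adjacent to both, must be shared.\<close>
    have "\<not> vpath [x, z] ?G"
      using p xyz by (auto simp: shortest_vpath_def)
    with path xyz have "x \<in> C - D \<and> z \<in> D - C \<or> x \<in> D - C \<and> z \<in> C - D" "y \<in> C \<inter> D"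
      by (auto simp: vpath_def vwalk_def)
    then show False
      using S sub xyz by auto
  qed
  then show "general_position_set ?G S"
    using S by (auto simp: general_position_set_def)
qed

lemma maximal_general_position_set_two_cliques_iff:
  assumes "C \<inter> D \<noteq> {}" "C - D \<noteq> {}" "D - C \<noteq> {}"
  shows "maximal_general_position_set (with_proj (two_cliques C D)) S \<longleftrightarrow>
    S = C \<or> S = D \<or> S = (C - D) \<union> (D - C)"
proof -
  define M where "M = (C - D) \<union> (D - C)"
  \<comment> \<open>Each of the three sets is the union of two of the three nonempty blocks, so none
    contains another; each is therefore maximal.\<close>
  have antichain: "\<not> C \<subseteq> D" "\<not> D \<subseteq> C" "\<not> C \<subseteq> M" "\<not> D \<subseteq> M" "\<not> M \<subseteq> C" "\<not> M \<subseteq> D"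
    using assms unfolding M_def by blast+
  show ?thesis
    unfolding maximal_general_position_set_def general_position_set_two_cliques_iff[OF assms(1)] M_def[symmetric]
  proof (rule iffI)
    assume "S = C \<or> S = D \<or> S = M"
    then show "(S \<subseteq> C \<or> S \<subseteq> D \<or> S \<subseteq> M) \<and>
        \<not> (\<exists>T. (T \<subseteq> C \<or> T \<subseteq> D \<or> T \<subseteq> M) \<and> S \<subset> T)"
      using antichain by (elim disjE) (simp_all add: psubset_eq, (meson order_antisym order_trans)+)
  qed (meson order_refl psubsetI)
qed

text \<open>Every general position set lies inside one of three finite sets that are themselves in
  general position, so the largest of these attains the maximum.\<close>

lemma gp_two_cliques:
  assumes "finite C" "finite D" "C \<inter> D \<noteq> {}"
  shows "gp (with_proj (two_cliques C D)) =
    Max {card C, card D, card (C - D) + card (D - C)}"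
proof -
  let ?M = "(C - D) \<union> (D - C)"
  have card_M: "card ?M = card (C - D) + card (D - C)"
    using assms by (intro card_Un_disjoint) auto
  let ?A = "{card S | S. S \<subseteq> C \<or> S \<subseteq> D \<or> S \<subseteq> ?M}"
  have le: "card S \<le> Max {card C, card D, card ?M}" if "S \<subseteq> C \<or> S \<subseteq> D \<or> S \<subseteq> ?M" for S
    using that assms card_mono[of C S] card_mono[of D S] card_mono[of ?M S] by auto
  have "Max ?A = Max {card C, card D, card ?M}"
  proof (rule Max_eqI)
    show "finite ?A"
      by (rule finite_subset[of _ "{..Max {card C, card D, card ?M}}"]) (use le in blast, simp)
    have "Max {card C, card D, card ?M} \<in> {card C, card D, card ?M}"
      by (rule Max_in) auto
    then show "Max {card C, card D, card ?M} \<in> ?A"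
      by blast
  qed (use le in blast)
  then show ?thesis
    by (simp only: gp_def general_position_set_two_cliques_iff[OF assms(3)] card_M)
qed

lemma gp_minus_two_cliques:
  assumes "finite C" "finite D" "C \<inter> D \<noteq> {}" "C - D \<noteq> {}" "D - C \<noteq> {}"
  shows "gp_minus (with_proj (two_cliques C D)) =
    Min {card C, card D, card (C - D) + card (D - C)}"
proof -
  let ?M = "(C - D) \<union> (D - C)"
  have "card ?M = card (C - D) + card (D - C)"
    using assms by (intro card_Un_disjoint) auto
  moreover have "{card S | S. S = C \<or> S = D \<or> S = ?M} = {card C, card D, card ?M}"
    by blast
  ultimately show ?thesis
    by (simp only: gp_minus_def maximal_general_position_set_two_cliques_iff[OF assms(3-5)])
qed

text \<open>The hypotheses order the three sizes as \<open>k + p \<le> k + q \<le> p + q\<close>,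
  which identifies the minimum and the maximum.\<close>

lemma ex_graph_gp_minus_gp_order:
  fixes k p q :: nat
  assumes "1 \<le> k" "k \<le> p" "p \<le> q"
  shows "\<exists>G :: nat pair_pre_digraph. pair_graph G \<and> Digraph_Component.connected (with_proj G) \<and>
    gp_minus (with_proj G) = k + p \<and> gp (with_proj G) = p + q \<and> card (pverts G) = p + q + k"
proof -
  \<comment> \<open>Two intervals overlapping in \<open>k\<close> numbers, with \<open>p\<close>
    numbers left on one side and \<open>q\<close> on the other.\<close>
  define C where "C = {..<p + k}"
  define D where "D = {p..<p + k + q}"
  have diffs: "C - D = {..<p}" "D - C = {p + k..<p + k + q}" "C \<inter> D = {p..<p + k}"
    and un: "C \<union> D = {..<p + k + q}"
    by (auto simp: C_def D_def)
  have fin: "finite C" "finite D"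
    by (auto simp: C_def D_def)
  have ne: "C \<inter> D \<noteq> {}" "C - D \<noteq> {}" "D - C \<noteq> {}"
    using assms by (auto simp: diffs lessThan_empty_iff)
  have cards: "card C = p + k" "card D = k + q" "card (C - D) = p" "card (D - C) = q"
    by (simp_all add: diffs) (simp_all add: C_def D_def)
  have "gp_minus (with_proj (two_cliques C D)) = k + p"
    using assms by (simp add: gp_minus_two_cliques[OF fin ne] cards)
  moreover have "gp (with_proj (two_cliques C D)) = p + q"
    using assms by (simp add: gp_two_cliques[OF fin ne(1)] cards)
  moreover have "card (pverts (two_cliques C D)) = p + q + k"
    by (simp add: un)
  ultimately show ?thesis
    using pair_graph_two_cliques[OF fin] connected_two_cliques[OF ne(1)] by blast
qed

theorem theorem3p4:
  fixes a b :: int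
  assumes "2 \<le> a" and "a < b"
  shows "\<exists>G :: nat pair_pre_digraph.
    pair_graph G \<and> Digraph_Component.connected (with_proj G) \<and>
    int (gp_minus (with_proj G)) = a \<and>
    int (gp (with_proj G)) = b \<and>
    int (card (pverts G)) = b + max 1 (a - \<lfloor>real_of_int b / 2\<rfloor>)"
proof -
  define k where "k = max 1 (a - b div 2)"
  have floor: "\<lfloor>real_of_int b / 2\<rfloor> = b div 2"
    using floor_divide_of_int_eq[of b 2] by simp
  \<comment> \<open>If \<open>k = 1\<close>, the second inequality is \<open>2 \<le> a\<close>;
    otherwise \<open>a - k = b div 2\<close>, and it follows from
    \<open>a \<le> b - 1 \<le> 2 * (b div 2)\<close>. The third holds because
    \<open>k \<ge> a - b div 2\<close> gives \<open>a - k \<le> b div 2\<close>.\<close>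
  have k: "1 \<le> k" "k \<le> a - k" "a - k \<le> b - (a - k)"
    using assms unfolding k_def by linarith+
  obtain G :: "nat pair_pre_digraph" where "pair_graph G" "Digraph_Component.connected (with_proj G)"
    "gp_minus (with_proj G) = nat k + nat (a - k)"
    "gp (with_proj G) = nat (a - k) + nat (b - (a - k))"
    "card (pverts G) = nat (a - k) + nat (b - (a - k)) + nat k"
    using ex_graph_gp_minus_gp_order[of "nat k" "nat (a - k)" "nat (b - (a - k))"] k
    by (auto simp: nat_mono Suc_le_eq)
  then show ?thesis
    using k by (intro exI[of _ G]) (simp add: floor k_def[symmetric])
qed

end
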